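(* The species $\mathfrak{o}$ of oriented trees and $\mathcal{O}$ of rooted oriented trees satisfy $\mathcal{O}=\mathfrak{o}+\mathcal{O}^2$, i.e. these species are naturally isomorphic.
   Context: Species are functors from the category of finite sets and bijections to itself; equality means natural isomorphism. $\mathfrak{o}[U]$ is the set of oriented trees on $U$: trees with vertex set $U$ in which each edge has been given an orientation. $\mathcal{O}=\mathfrak{o}^\bullet$ is the species of rooted oriented trees, i.e. $\mathcal{O}[U]=\{(t,u):t\in\mathfrak{o}[U],u\in U\}$. The sum is $(F+G)[U]=F[U]\sqcup G[U]$ and the product $(FG)[U]=\bigsqcup_{U_1\sqcup U_2=U}F[U_1]\times G[U_2]$ over ordered pairs of complementary subsets; $\mathcal{O}^2=\mathcal{O}\mathcal{O}$. Transports act by relabelling. *)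

theory Defs
  imports Main
begin

section \<open>Species\<close>

text \<open>
  The finite sets are the finite subsets of an arbitrary type \<open>'a\<close>. A morphism from \<open>U\<close> to \<open>V\<close>
  is given by a total function \<open>\<sigma>\<close> with \<open>bij_betw \<sigma> U V\<close>, only its values on \<open>U\<close> being relevant
  (see \<open>transport_cong\<close> below); \<open>transport F U \<sigma>\<close> is the induced map on the structures on \<open>U\<close>.
\<close>

record ('a, 's) species_data =
  structs :: "'a set \<Rightarrow> 's set"
  transport :: "'a set \<Rightarrow> ('a \<Rightarrow> 'a) \<Rightarrow> 's \<Rightarrow> 's"

locale species =
  fixes F :: "('a, 's) species_data"
  assumes finite_structs: "finite U \<Longrightarrow> finite (structs F U)"
    and transport_bij:
      "\<lbrakk>finite U; bij_betw \<sigma> U V\<rbrakk> \<Longrightarrow> bij_betw (transport F U \<sigma>) (structs F U) (structs F V)"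
    and transport_id: "\<lbrakk>finite U; s \<in> structs F U\<rbrakk> \<Longrightarrow> transport F U id s = s"
    and transport_comp:
      "\<lbrakk>finite U; bij_betw \<sigma> U V; bij_betw \<tau> V W; s \<in> structs F U\<rbrakk>
        \<Longrightarrow> transport F U (\<tau> \<circ> \<sigma>) s = transport F V \<tau> (transport F U \<sigma> s)"
    and transport_cong:
      "\<lbrakk>finite U; bij_betw \<sigma> U V; \<And>x. x \<in> U \<Longrightarrow> \<sigma> x = \<sigma>' x; s \<in> structs F U\<rbrakk>
        \<Longrightarrow> transport F U \<sigma> s = transport F U \<sigma>' s"

definition natural_iso ::
  "('a, 's) species_data \<Rightarrow> ('a, 't) species_data \<Rightarrow> ('a set \<Rightarrow> 's \<Rightarrow> 't) \<Rightarrow> bool" where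
  "natural_iso F G \<alpha> \<longleftrightarrow>
     (\<forall>U. finite U \<longrightarrow> bij_betw (\<alpha> U) (structs F U) (structs G U)) \<and>
     (\<forall>U V \<sigma>. finite U \<and> bij_betw \<sigma> U V \<longrightarrow>
        (\<forall>s \<in> structs F U. \<alpha> V (transport F U \<sigma> s) = transport G U \<sigma> (\<alpha> U s)))"

definition species_iso ::
  "('a, 's) species_data \<Rightarrow> ('a, 't) species_data \<Rightarrow> bool" (infix "\<cong>\<^sub>s" 50) where
  "F \<cong>\<^sub>s G \<longleftrightarrow> species F \<and> species G \<and> (\<exists>\<alpha>. natural_iso F G \<alpha>)"

definition species_sum ::
  "('a, 's) species_data \<Rightarrow> ('a, 't) species_data \<Rightarrow> ('a, 's + 't) species_data"
  (infixl "+\<^sub>s" 65) where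
  "F +\<^sub>s G =
     \<lparr> structs = (\<lambda>U. structs F U <+> structs G U),
       transport = (\<lambda>U \<sigma>. map_sum (transport F U \<sigma>) (transport G U \<sigma>)) \<rparr>"

definition species_prod ::
  "('a, 's) species_data \<Rightarrow> ('a, 't) species_data
     \<Rightarrow> ('a, ('a set \<times> 'a set) \<times> ('s \<times> 't)) species_data"
  (infixl "*\<^sub>s" 70) where
  "F *\<^sub>s G =
     \<lparr> structs = (\<lambda>U. SIGMA (U\<^sub>1, U\<^sub>2) : {(U\<^sub>1, U\<^sub>2). U\<^sub>1 \<union> U\<^sub>2 = U \<and> U\<^sub>1 \<inter> U\<^sub>2 = {}}.
                    structs F U\<^sub>1 \<times> structs G U\<^sub>2),
       transport = (\<lambda>U \<sigma> ((U\<^sub>1, U\<^sub>2), (s, t)).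
                    ((\<sigma> ` U\<^sub>1, \<sigma> ` U\<^sub>2), (transport F U\<^sub>1 \<sigma> s, transport G U\<^sub>2 \<sigma> t))) \<rparr>"

definition pointing :: "('a, 's) species_data \<Rightarrow> ('a, 's \<times> 'a) species_data" where
  "pointing F =
     \<lparr> structs = (\<lambda>U. structs F U \<times> U),
       transport = (\<lambda>U \<sigma>. map_prod (transport F U \<sigma>) \<sigma>) \<rparr>"


section \<open>Oriented trees\<close>

definition connected_graph :: "'a set \<Rightarrow> 'a set set \<Rightarrow> bool" where
  "connected_graph U E \<longleftrightarrow>
     U \<noteq> {} \<and> (\<forall>u\<in>U. \<forall>v\<in>U. (u, v) \<in> {(x, y). {x, y} \<in> E}\<^sup>*)"

definition graph_cycle :: "'a set set \<Rightarrow> 'a list \<Rightarrow> bool" where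
  "graph_cycle E vs \<longleftrightarrow>
     length vs \<ge> 3 \<and> distinct vs \<and> successively (\<lambda>x y. {x, y} \<in> E) vs \<and> {last vs, hd vs} \<in> E"

definition tree_on :: "'a set \<Rightarrow> 'a set set \<Rightarrow> bool" where
  "tree_on U E \<longleftrightarrow>
     (\<forall>e\<in>E. e \<subseteq> U \<and> card e = 2) \<and> connected_graph U E \<and> (\<nexists>vs. graph_cycle E vs)"

definition unorient :: "'a \<times> 'a \<Rightarrow> 'a set" where
  "unorient = (\<lambda>(x, y). {x, y})"

text \<open>
  An oriented tree is given by its set \<open>A\<close> of arcs; injectivity says that every edge of the
  underlying tree receives exactly one of its two orientations.
\<close>

definition oriented_tree_on :: "'a set \<Rightarrow> ('a \<times> 'a) set \<Rightarrow> bool" where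
  "oriented_tree_on U A \<longleftrightarrow> tree_on U (unorient ` A) \<and> inj_on unorient A"

definition oriented_trees :: "('a, ('a \<times> 'a) set) species_data" where
  "oriented_trees =
     \<lparr> structs = (\<lambda>U. {A. oriented_tree_on U A}),
       transport = (\<lambda>U \<sigma> A. map_prod \<sigma> \<sigma> ` A) \<rparr>"

definition rooted_oriented_trees :: "('a, ('a \<times> 'a) set \<times> 'a) species_data" where
  "rooted_oriented_trees = pointing oriented_trees"


section \<open>Well-definedness\<close>

text \<open>
  Bijectivity of transports follows from functoriality, so it suffices that they map
  structures to structures.
\<close>

lemma speciesI:
  assumes fin: "\<And>U. finite U \<Longrightarrow> finite (structs F U)"
    and maps: "\<And>U V \<sigma> s. \<lbrakk>finite U; bij_betw \<sigma> U V; s \<in> structs F U\<rbrakk>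
                 \<Longrightarrow> transport F U \<sigma> s \<in> structs F V"
    and ident: "\<And>U s. \<lbrakk>finite U; s \<in> structs F U\<rbrakk> \<Longrightarrow> transport F U id s = s"
    and comp: "\<And>U V W \<sigma> \<tau> s. \<lbrakk>finite U; bij_betw \<sigma> U V; bij_betw \<tau> V W; s \<in> structs F U\<rbrakk>
                 \<Longrightarrow> transport F U (\<tau> \<circ> \<sigma>) s = transport F V \<tau> (transport F U \<sigma> s)"
    and cong: "\<And>U V \<sigma> \<sigma>' s. \<lbrakk>finite U; bij_betw \<sigma> U V; \<And>x. x \<in> U \<Longrightarrow> \<sigma> x = \<sigma>' x; s \<in> structs F U\<rbrakk>
                 \<Longrightarrow> transport F U \<sigma> s = transport F U \<sigma>' s"
  shows "species F"
proof
  have inverse: "transport F V \<tau> (transport F U \<sigma> s) = s"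
    if U: "finite U" and \<sigma>: "bij_betw \<sigma> U V" and \<tau>: "bij_betw \<tau> V U"
      and inv: "\<And>x. x \<in> U \<Longrightarrow> \<tau> (\<sigma> x) = x" and s: "s \<in> structs F U" for U V \<sigma> \<tau> s
  proof -
    have "transport F V \<tau> (transport F U \<sigma> s) = transport F U (\<tau> \<circ> \<sigma>) s"
      using comp[OF U \<sigma> \<tau> s] by simp
    also have "\<dots> = transport F U id s"
      by (rule cong[OF U bij_betw_trans[OF \<sigma> \<tau>] _ s]) (simp add: inv)
    finally show ?thesis using ident[OF U s] by simp
  qed
  fix U V :: "'a set" and \<sigma>
  assume U: "finite U" and \<sigma>: "bij_betw \<sigma> U V"
  let ?\<tau> = "inv_into U \<sigma>"
  have V: "finite V" using U \<sigma> bij_betw_finite by blast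
  have \<tau>: "bij_betw ?\<tau> V U" using \<sigma> by (rule bij_betw_inv_into)
  show "bij_betw (transport F U \<sigma>) (structs F U) (structs F V)"
  proof (rule bij_betw_byWitness[where f' = "transport F V ?\<tau>"])
    show "\<forall>s\<in>structs F U. transport F V ?\<tau> (transport F U \<sigma> s) = s"
      using inverse[OF U \<sigma> \<tau>] bij_betw_inv_into_left[OF \<sigma>] by blast
    show "\<forall>s\<in>structs F V. transport F U \<sigma> (transport F V ?\<tau> s) = s"
      using inverse[OF V \<tau> \<sigma>] bij_betw_inv_into_right[OF \<sigma>] by blast
  qed (use maps[OF U \<sigma>] maps[OF V \<tau>] in auto)
qed (fact fin ident comp cong)+

lemma (in species) transport_in:
  "\<lbrakk>finite U; bij_betw \<sigma> U V; s \<in> structs F U\<rbrakk> \<Longrightarrow> transport F U \<sigma> s \<in> structs F V"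
  using transport_bij bij_betwE by blast

lemma species_sum:
  assumes "species F" and "species G"
  shows "species (F +\<^sub>s G)"
proof -
  interpret F: species F by fact
  interpret G: species G by fact
  show ?thesis
  proof (rule speciesI)
    fix U :: "'a set" assume "finite U"
    then show "finite (structs (F +\<^sub>s G) U)"
      by (simp add: species_sum_def F.finite_structs G.finite_structs)
  next
    fix U V :: "'a set" and \<sigma> \<sigma>' s
    assume "finite U" "bij_betw \<sigma> U V" "\<And>x. x \<in> U \<Longrightarrow> \<sigma> x = \<sigma>' x" "s \<in> structs (F +\<^sub>s G) U"
    then show "transport (F +\<^sub>s G) U \<sigma> s = transport (F +\<^sub>s G) U \<sigma>' s"
      using F.transport_cong[of U \<sigma> V \<sigma>'] G.transport_cong[of U \<sigma> V \<sigma>']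
      by (auto simp: species_sum_def)
  qed (auto simp: species_sum_def F.transport_in G.transport_in F.transport_id G.transport_id
        intro: F.transport_comp G.transport_comp)
qed

lemma species_prod:
  assumes "species F" and "species G"
  shows "species (F *\<^sub>s G)"
proof -
  interpret F: species F by fact
  interpret G: species G by fact
  have split: "finite U\<^sub>1" "finite U\<^sub>2" "bij_betw \<sigma> U\<^sub>1 (\<sigma> ` U\<^sub>1)" "bij_betw \<sigma> U\<^sub>2 (\<sigma> ` U\<^sub>2)"
    "\<sigma> ` U\<^sub>1 \<union> \<sigma> ` U\<^sub>2 = V" "\<sigma> ` U\<^sub>1 \<inter> \<sigma> ` U\<^sub>2 = {}"
    if "finite U" "bij_betw \<sigma> U V" "U\<^sub>1 \<union> U\<^sub>2 = U" "U\<^sub>1 \<inter> U\<^sub>2 = {}" for U V U\<^sub>1 U\<^sub>2 \<sigma>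
    using that by (auto simp: bij_betw_def inj_on_def)
  show ?thesis
  proof (rule speciesI)
    fix U :: "'a set" assume U: "finite U"
    have "structs (F *\<^sub>s G) U \<subseteq>
        (Pow U \<times> Pow U) \<times> ((\<Union>X\<in>Pow U. structs F X) \<times> (\<Union>X\<in>Pow U. structs G X))"
      by (auto simp: species_prod_def)
    moreover have "finite \<dots>"
      using U by (auto intro!: finite_cartesian_product F.finite_structs G.finite_structs
          intro: finite_subset)
    ultimately show "finite (structs (F *\<^sub>s G) U)" by (rule finite_subset)
  next
    fix U V :: "'a set" and \<sigma> p
    assume A: "finite U" "bij_betw \<sigma> U V" "p \<in> structs (F *\<^sub>s G) U"
    then obtain U\<^sub>1 U\<^sub>2 s t where p: "p = ((U\<^sub>1, U\<^sub>2), (s, t))" "U\<^sub>1 \<union> U\<^sub>2 = U" "U\<^sub>1 \<inter> U\<^sub>2 = {}"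
      "s \<in> structs F U\<^sub>1" "t \<in> structs G U\<^sub>2" by (auto simp: species_prod_def)
    note sp = split[OF A(1,2) p(2,3)]
    show "transport (F *\<^sub>s G) U \<sigma> p \<in> structs (F *\<^sub>s G) V"
      using F.transport_in[OF sp(1,3) p(4)] G.transport_in[OF sp(2,4) p(5)] sp(5,6)
      by (auto simp: species_prod_def p(1))
  next
    fix U p assume "finite U" "p \<in> structs (F *\<^sub>s G) U"
    then show "transport (F *\<^sub>s G) U id p = p"
      by (auto simp: species_prod_def F.transport_id G.transport_id)
  next
    fix U V W :: "'a set" and \<sigma> \<tau> p
    assume A: "finite U" "bij_betw \<sigma> U V" and \<tau>: "bij_betw \<tau> V W" and B: "p \<in> structs (F *\<^sub>s G) U"
    then obtain U\<^sub>1 U\<^sub>2 s t where p: "p = ((U\<^sub>1, U\<^sub>2), (s, t))" "U\<^sub>1 \<union> U\<^sub>2 = U" "U\<^sub>1 \<inter> U\<^sub>2 = {}"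
      "s \<in> structs F U\<^sub>1" "t \<in> structs G U\<^sub>2" by (auto simp: species_prod_def)
    note sp = split[OF A p(2,3)]
    have V: "finite V" using A bij_betw_finite by blast
    note sp' = split[OF V \<tau> sp(5,6)]
    show "transport (F *\<^sub>s G) U (\<tau> \<circ> \<sigma>) p = transport (F *\<^sub>s G) V \<tau> (transport (F *\<^sub>s G) U \<sigma> p)"
      using F.transport_comp[OF sp(1,3) sp'(3) p(4)] G.transport_comp[OF sp(2,4) sp'(4) p(5)]
      by (simp add: species_prod_def p(1) image_comp)
  next
    fix U V :: "'a set" and \<sigma> \<sigma>' p
    assume A: "finite U" "bij_betw \<sigma> U V" and eq: "\<And>x. x \<in> U \<Longrightarrow> \<sigma> x = \<sigma>' x"
      and B: "p \<in> structs (F *\<^sub>s G) U"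
    then obtain U\<^sub>1 U\<^sub>2 s t where p: "p = ((U\<^sub>1, U\<^sub>2), (s, t))" "U\<^sub>1 \<union> U\<^sub>2 = U" "U\<^sub>1 \<inter> U\<^sub>2 = {}"
      "s \<in> structs F U\<^sub>1" "t \<in> structs G U\<^sub>2" by (auto simp: species_prod_def)
    note sp = split[OF A p(2,3)]
    have "transport F U\<^sub>1 \<sigma> s = transport F U\<^sub>1 \<sigma>' s"
      by (rule F.transport_cong[OF sp(1,3) _ p(4)]) (use eq p(2) in auto)
    moreover have "transport G U\<^sub>2 \<sigma> t = transport G U\<^sub>2 \<sigma>' t"
      by (rule G.transport_cong[OF sp(2,4) _ p(5)]) (use eq p(2) in auto)
    moreover have "\<sigma> ` U\<^sub>1 = \<sigma>' ` U\<^sub>1" "\<sigma> ` U\<^sub>2 = \<sigma>' ` U\<^sub>2"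
      using eq p(2) by (auto intro!: image_cong)
    ultimately show "transport (F *\<^sub>s G) U \<sigma> p = transport (F *\<^sub>s G) U \<sigma>' p"
      by (simp add: species_prod_def p(1))
  qed
qed

lemma species_pointing:
  assumes "species F"
  shows "species (pointing F)"
proof -
  interpret F: species F by fact
  show ?thesis
  proof (rule speciesI)
    fix U V :: "'a set" and \<sigma> \<sigma>' s
    assume "finite U" "bij_betw \<sigma> U V" "\<And>x. x \<in> U \<Longrightarrow> \<sigma> x = \<sigma>' x" "s \<in> structs (pointing F) U"
    then show "transport (pointing F) U \<sigma> s = transport (pointing F) U \<sigma>' s"
      using F.transport_cong[of U \<sigma> V \<sigma>'] by (auto simp: pointing_def)
  qed (auto simp: pointing_def F.finite_structs F.transport_in F.transport_id bij_betw_apply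
        intro: F.transport_comp)
qed

lemma unorient_map_prod: "unorient (map_prod \<sigma> \<sigma> a) = \<sigma> ` unorient a"
  by (cases a) (simp add: unorient_def)

lemma tree_on_image:
  assumes \<sigma>: "bij_betw \<sigma> U V" and T: "tree_on U E"
  shows "tree_on V ((`) \<sigma> ` E)"
proof -
  let ?E = "(`) \<sigma> ` E" and ?\<tau> = "inv_into U \<sigma>"
  have inj: "inj_on \<sigma> U" and V: "V = \<sigma> ` U" using \<sigma> by (auto simp: bij_betw_def)
  have E: "e \<subseteq> U" "card e = 2" if "e \<in> E" for e using T that by (auto simp: tree_on_def)
  have pull: "?\<tau> ` e \<in> E" "e \<subseteq> V" if e: "e \<in> ?E" for e
  proof -
    obtain d where d: "d \<in> E" "e = \<sigma> ` d" using e by blast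
    show "?\<tau> ` e \<in> E" using inv_into_image_cancel[OF inj E(1)[OF d(1)]] d by simp
    show "e \<subseteq> V" using E(1)[OF d(1)] d(2) V by auto
  qed
  have "e \<subseteq> V \<and> card e = 2" if "e \<in> ?E" for e
    using that E V by (auto simp: card_image inj_on_subset[OF inj])
  moreover have "connected_graph V ?E"
  proof -
    have walk: "(\<sigma> u, \<sigma> v) \<in> {(x, y). {x, y} \<in> ?E}\<^sup>*" if "(u, v) \<in> {(x, y). {x, y} \<in> E}\<^sup>*" for u v
      using that
    proof induction
      case (step x y)
      then have "\<sigma> ` {x, y} \<in> ?E" by blast
      then show ?case using step.IH by (auto intro: rtrancl_into_rtrancl)
    qed simp
    show ?thesis using T walk by (auto simp: tree_on_def connected_graph_def V)
  qed
  moreover have "\<not> graph_cycle ?E vs" for vs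
  proof
    assume C: "graph_cycle ?E vs"
    then have len: "length vs \<ge> 3" and ne: "vs \<noteq> []" by (auto simp: graph_cycle_def)
    have edge: "{?\<tau> x, ?\<tau> y} \<in> E" if "{x, y} \<in> ?E" for x y using pull(1)[OF that] by simp
    have succ: "successively (\<lambda>x y. {x, y} \<in> ?E) vs" using C by (simp add: graph_cycle_def)
    have "set vs \<subseteq> V"
    proof
      fix x assume "x \<in> set vs"
      then obtain i where i: "i < length vs" "x = vs ! i" by (auto simp: in_set_conv_nth)
      show "x \<in> V"
      proof (cases "Suc i < length vs")
        case True
        then have "{vs ! i, vs ! Suc i} \<in> ?E" using succ by (simp add: successively_conv_nth)
        then show ?thesis using pull(2) i by blast
      next
        case False
        then have "i = length vs - 1" using i by simp
        then have "x = last vs" using i ne by (simp add: last_conv_nth)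
        moreover have "{last vs, hd vs} \<in> ?E" using C by (simp add: graph_cycle_def)
        ultimately show ?thesis using pull(2) by blast
      qed
    qed
    then have "distinct (map ?\<tau> vs)"
      using C V by (auto simp: graph_cycle_def distinct_map intro: inj_on_inv_into)
    moreover have "successively (\<lambda>x y. {x, y} \<in> E) (map ?\<tau> vs)"
      using succ edge by (auto simp: successively_conv_nth)
    moreover have "{last (map ?\<tau> vs), hd (map ?\<tau> vs)} \<in> E"
      using C edge ne by (simp add: graph_cycle_def last_map hd_map)
    ultimately have "graph_cycle E (map ?\<tau> vs)" using len by (simp add: graph_cycle_def)
    then show False using T by (auto simp: tree_on_def)
  qed
  ultimately show ?thesis by (auto simp: tree_on_def)
qed

lemma oriented_tree_on_subset:
  assumes "oriented_tree_on U A"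
  shows "A \<subseteq> U \<times> U"
  using assms by (fastforce simp: oriented_tree_on_def tree_on_def unorient_def)

lemma species_oriented_trees: "species oriented_trees"
proof (rule speciesI)
  fix U :: "'a set" assume "finite U"
  then show "finite (structs oriented_trees U)"
    by (auto simp: oriented_trees_def dest: oriented_tree_on_subset
        intro!: finite_subset[of _ "Pow (U \<times> U)"])
next
  fix U V :: "'a set" and \<sigma> A
  assume \<sigma>: "bij_betw \<sigma> U V" and A: "A \<in> structs oriented_trees U"
  then have A: "oriented_tree_on U A" by (simp add: oriented_trees_def)
  have img: "unorient ` map_prod \<sigma> \<sigma> ` A = (`) \<sigma> ` unorient ` A"
    by (simp add: image_image unorient_map_prod)
  have "inj_on unorient (map_prod \<sigma> \<sigma> ` A)"
  proof (rule inj_onI)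
    fix a b assume ab: "a \<in> map_prod \<sigma> \<sigma> ` A" "b \<in> map_prod \<sigma> \<sigma> ` A" and eq: "unorient a = unorient b"
    from ab obtain c d where cd: "c \<in> A" "d \<in> A" "a = map_prod \<sigma> \<sigma> c" "b = map_prod \<sigma> \<sigma> d"
      by (meson imageE)
    have "\<sigma> ` unorient c = \<sigma> ` unorient d" using eq cd by (simp add: unorient_map_prod)
    moreover have "unorient c \<subseteq> U" "unorient d \<subseteq> U"
      using A cd by (auto simp: oriented_tree_on_def tree_on_def)
    ultimately have "unorient c = unorient d"
      using \<sigma> by (metis bij_betw_def inj_on_image_eq_iff)
    then have "c = d" using A cd by (auto simp: oriented_tree_on_def inj_on_def)
    then show "a = b" using cd by simp
  qed
  then show "transport oriented_trees U \<sigma> A \<in> structs oriented_trees V"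
    using A tree_on_image[OF \<sigma>] by (simp add: oriented_trees_def oriented_tree_on_def img)
next
  fix U V W :: "'a set" and \<sigma> \<tau> A
  show "transport oriented_trees U (\<tau> \<circ> \<sigma>) A
      = transport oriented_trees V \<tau> (transport oriented_trees U \<sigma> A)"
    by (simp add: oriented_trees_def image_comp map_prod.comp)
next
  fix U V :: "'a set" and \<sigma> \<sigma>' :: "'a \<Rightarrow> 'a" and A
  assume eq: "\<And>x. x \<in> U \<Longrightarrow> \<sigma> x = \<sigma>' x" and "A \<in> structs oriented_trees U"
  then have "A \<subseteq> U \<times> U" using oriented_tree_on_subset by (auto simp: oriented_trees_def)
  then show "transport oriented_trees U \<sigma> A = transport oriented_trees U \<sigma>' A"
    using eq by (auto simp: oriented_trees_def intro!: image_cong)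
qed (simp add: oriented_trees_def prod.map_id0)

lemma species_rooted_oriented_trees: "species rooted_oriented_trees"
  unfolding rooted_oriented_trees_def by (intro species_pointing species_oriented_trees)

end

theory Submission
  imports Defs
begin

text \<open>
  Joining the two roots by an arc identifies \<open>\<O>\<^sup>2\<close> with oriented trees with a distinguished arc, so
  one has to match, naturally, the vertices of an oriented tree with its arcs and one extra point.
  Removing an arc leaves two parts; send the arc to its end in the lighter part, where a tie is
  broken by the orientation of the arc. Two distinct arcs cannot be sent to the same vertex \<open>u\<close>,
  since the two heavier parts would be disjoint, would both miss \<open>u\<close>, and would both contain at
  least half of the vertices. As a tree has one vertex more than arcs, exactly one vertex is missed,
  and this one corresponds to the extra point.
\<close>

section \<open>Oriented trees as relations\<close>

text \<open>The equivalence whose classes are the connected components of the underlying undirected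
  graph. The closure is taken over the whole type, so a point on no arc is linked to itself
  only.\<close>

abbreviation linked :: "('a \<times> 'a) set \<Rightarrow> ('a \<times> 'a) set" where
  "linked A \<equiv> (A \<union> A\<inverse>)\<^sup>*"

lemma linked_sym: "(x, y) \<in> linked A \<Longrightarrow> (y, x) \<in> linked A"
  by (rule symD[OF sym_rtrancl]) (auto simp: sym_def)

lemma linked_mono: "A \<subseteq> B \<Longrightarrow> linked A \<subseteq> linked B"
  by (intro rtrancl_mono) auto

text \<open>A set that no arc enters or leaves is a union of components. This is the device that
  keeps a walk on one side of a cut.\<close>

lemma linked_closed:
  assumes "(x, y) \<in> linked A" and "x \<in> X"
    and "\<And>a b. (a, b) \<in> A \<Longrightarrow> a \<in> X \<longleftrightarrow> b \<in> X"
  shows "y \<in> X"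
  using assms(1) by induction (use assms(2,3) in auto)

text \<open>Applying \<open>f\<close> to a walk keeps its steps along \<open>B\<close> and makes its
  steps along \<open>C\<close> stationary. It serves to contract one of two joined trees to a single
  vertex.\<close>

lemma linked_retract:
  assumes "(x, y) \<in> linked (B \<union> C)"
    and "\<And>a b. (a, b) \<in> B \<Longrightarrow> f a = a \<and> f b = b"
    and "\<And>a b. (a, b) \<in> C \<Longrightarrow> f a = f b"
  shows "(f x, f y) \<in> linked B"
  using assms(1)
proof induction
  case (step y z)
  then consider "(y, z) \<in> B \<union> B\<inverse>" | "(y, z) \<in> C \<union> C\<inverse>" by auto
  then show ?case
  proof cases
    case 1
    then have "(f y, f z) \<in> B \<union> B\<inverse>" using assms(2) by fastforce
    then show ?thesis using step.IH by (rule rtrancl_into_rtrancl[rotated])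
  next
    case 2
    then have "f y = f z" using assms(3) by fastforce
    then show ?thesis using step.IH by simp
  qed
qed simp

section \<open>Simple paths and walks\<close>

text \<open>In the induction, a new endpoint that already lies on the path is handled by cutting the
  path there. Simple paths are what \<open>graph_cycle\<close> asks for.\<close>

lemma rtrancl_distinct_path:
  assumes "(x, y) \<in> R\<^sup>*"
  shows "\<exists>vs. vs \<noteq> [] \<and> hd vs = x \<and> last vs = y \<and> distinct vs
    \<and> successively (\<lambda>a b. (a, b) \<in> R) vs"
  using assms
proof induction
  case base
  show ?case by (rule exI[of _ "[x]"]) simp
next
  case (step y z)
  then obtain vs where vs: "vs \<noteq> []" "hd vs = x" "last vs = y" "distinct vs"
    "successively (\<lambda>a b. (a, b) \<in> R) vs" by blast
  show ?case
  proof (cases "z \<in> set vs")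
    case True
    then obtain ys zs where s: "vs = (ys @ [z]) @ zs" by (auto simp: in_set_conv_decomp)
    have "successively (\<lambda>a b. (a, b) \<in> R) (ys @ [z])"
      using vs(5) unfolding s successively_append_iff by blast
    moreover have "hd (ys @ [z]) = x" using vs(2) s by (cases ys) auto
    ultimately show ?thesis using vs(4) s by (intro exI[of _ "ys @ [z]"]) auto
  next
    case False
    then show ?thesis using vs step.hyps(2)
      by (intro exI[of _ "vs @ [z]"]) (auto simp: successively_append_iff)
  qed
qed

lemma successively_rtrancl:
  assumes "successively (\<lambda>a b. (a, b) \<in> R) vs" and "vs \<noteq> []"
  shows "(hd vs, last vs) \<in> R\<^sup>*"
  using assms
proof (induction vs rule: induct_list012)
  case (3 x y zs)
  then show ?case by (auto intro: converse_rtrancl_into_rtrancl)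
qed auto

section \<open>Oriented trees as connected graphs in which every arc is a bridge\<close>

lemma unorient_eq_iff: "unorient (a, b) = {x, y} \<longleftrightarrow> (a, b) = (x, y) \<or> (a, b) = (y, x)"
  by (auto simp: unorient_def doubleton_eq_iff)

lemma in_unorient_image: "{x, y} \<in> unorient ` A \<longleftrightarrow> (x, y) \<in> A \<union> A\<inverse>"
proof -
  have "{x, y} \<in> unorient ` A \<longleftrightarrow> (\<exists>a b. (a, b) \<in> A \<and> unorient (a, b) = {x, y})"
    by force
  then show ?thesis by (auto simp: unorient_eq_iff)
qed

text \<open>
  In the last condition, \<open>(x, y)\<close> being unlinked also excludes loops and pairs of opposite arcs.
\<close>

lemma oriented_tree_on_iff:
  "oriented_tree_on U A \<longleftrightarrow>
     U \<noteq> {} \<and> A \<subseteq> U \<times> U \<and> (\<forall>u\<in>U. \<forall>v\<in>U. (u, v) \<in> linked A) \<and>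
     (\<forall>x y. (x, y) \<in> A \<longrightarrow> (x, y) \<notin> linked (A - {(x, y)}))"
  (is "_ \<longleftrightarrow> ?R")
proof -
  have adj: "{(x, y). {x, y} \<in> unorient ` A} = A \<union> A\<inverse>"
    unfolding in_unorient_image by auto
  show ?thesis
  proof
    assume T: "oriented_tree_on U A"
    then have inj: "inj_on unorient A" and tree: "tree_on U (unorient ` A)"
      by (simp_all add: oriented_tree_on_def)
    have "(x, y) \<notin> linked (A - {(x, y)})" if xy: "(x, y) \<in> A" for x y
    proof
      let ?B = "A - {(x, y)}"
      assume "(x, y) \<in> linked ?B"
      then obtain vs where vs: "vs \<noteq> []" "hd vs = x" "last vs = y" "distinct vs"
        and succ: "successively (\<lambda>a b. (a, b) \<in> ?B \<union> ?B\<inverse>) vs"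
        using rtrancl_distinct_path by metis
      have "card (unorient (x, y)) = 2" using tree xy by (auto simp: tree_on_def)
      then have "x \<noteq> y" by (auto simp: unorient_def)
      have "(y, x) \<notin> A"
        using inj_onD[OF inj _ xy, of "(y, x)"] \<open>x \<noteq> y\<close> by (auto simp: unorient_def)
      \<comment> \<open>A one-vertex path would make the arc a loop. A two-vertex path would use
        either the deleted arc or its reverse, which injectivity of \<open>unorient\<close>
        forbids.\<close>
      have "length vs \<ge> 3"
      proof (rule ccontr)
        assume "\<not> length vs \<ge> 3"
        then consider "vs = [x]" "x = y" | "vs = [x, y]"
          using vs(1-3) by (cases vs; cases "tl vs"; cases "tl (tl vs)") auto
        then show False
          by cases (use \<open>x \<noteq> y\<close> \<open>(y, x) \<notin> A\<close> succ in auto)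
      qed
      moreover have "successively (\<lambda>x y. {x, y} \<in> unorient ` A) vs"
        using succ unfolding in_unorient_image by (rule successively_mono) auto
      moreover have "{last vs, hd vs} \<in> unorient ` A"
        unfolding in_unorient_image using vs xy by simp
      ultimately have "graph_cycle (unorient ` A) vs" using vs(4) by (simp add: graph_cycle_def)
      then show False using tree by (auto simp: tree_on_def)
    qed
    then show ?R
      using tree oriented_tree_on_subset[OF T]
      by (simp add: tree_on_def connected_graph_def adj)
  next
    assume R: ?R
    then have bridge: "\<And>x y. (x, y) \<in> A \<Longrightarrow> (x, y) \<notin> linked (A - {(x, y)})" by blast
    have loop: "x \<noteq> y" if "(x, y) \<in> A" for x y using bridge[OF that] by auto
    have opp: "(y, x) \<notin> A" if "(x, y) \<in> A" for x y
      using bridge[OF that] loop[OF that] by (auto intro: r_into_rtrancl)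
    have "inj_on unorient A"
      by (rule inj_onI) (use opp in \<open>auto simp: unorient_def doubleton_eq_iff\<close>)
    moreover have "e \<subseteq> U \<and> card e = 2" if "e \<in> unorient ` A" for e
      using that R loop by (fastforce simp: unorient_def)
    moreover have "\<not> graph_cycle (unorient ` A) vs" for vs
    proof
      assume C: "graph_cycle (unorient ` A) vs"
      then have len: "length vs \<ge> 3" and ne: "vs \<noteq> []" and dist: "distinct vs"
        and succ: "successively (\<lambda>x y. (x, y) \<in> A \<union> A\<inverse>) vs"
        and close: "(last vs, hd vs) \<in> A \<union> A\<inverse>"
        unfolding graph_cycle_def in_unorient_image by auto
      \<comment> \<open>The closing edge of the cycle is the arc that fails to be a bridge: the rest
        of the cycle still links its ends.\<close>
      obtain x y where xy: "(x, y) \<in> A" "{x, y} = {hd vs, last vs}"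
        using close by auto
      have "successively (\<lambda>a b. (a, b) \<in> (A - {(x, y)}) \<union> (A - {(x, y)})\<inverse>) vs"
        unfolding successively_conv_nth
      proof (intro allI impI)
        fix i assume i: "Suc i < length vs"
        \<comment> \<open>Here the length bound matters: with only two vertices, the consecutive
          pair would be the closing edge itself.\<close>
        have "{vs ! i, vs ! Suc i} \<noteq> {hd vs, last vs}"
          using i len ne dist
          by (auto simp: doubleton_eq_iff hd_conv_nth last_conv_nth nth_eq_iff_index_eq)
        moreover have "(vs ! i, vs ! Suc i) \<in> A \<union> A\<inverse>"
          using succ i by (simp add: successively_conv_nth)
        ultimately show "(vs ! i, vs ! Suc i) \<in> (A - {(x, y)}) \<union> (A - {(x, y)})\<inverse>"
          using xy(2) by (auto simp: insert_commute)
      qed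
      from successively_rtrancl[OF this ne]
      have "(x, y) \<in> linked (A - {(x, y)})"
        using xy(2) linked_sym by (fastforce simp: doubleton_eq_iff)
      then show False using bridge xy(1) by blast
    qed
    ultimately show "oriented_tree_on U A"
      using R by (simp add: oriented_tree_on_def tree_on_def connected_graph_def adj)
  qed
qed


section \<open>Joining and splitting oriented trees along an arc\<close>

text \<open>The new arc is a bridge because no other arc leaves \<open>U\<^sub>1\<close>. An old arc
  stays a bridge because contracting the opposite tree, together with the new arc, to a root turns a
  walk avoiding the old arc into such a walk inside its own tree.\<close>

lemma oriented_tree_on_join:
  assumes T\<^sub>1: "oriented_tree_on U\<^sub>1 A\<^sub>1" and T\<^sub>2: "oriented_tree_on U\<^sub>2 A\<^sub>2"
    and disj: "U\<^sub>1 \<inter> U\<^sub>2 = {}" and r: "r\<^sub>1 \<in> U\<^sub>1" "r\<^sub>2 \<in> U\<^sub>2"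
  shows "oriented_tree_on (U\<^sub>1 \<union> U\<^sub>2) (insert (r\<^sub>1, r\<^sub>2) (A\<^sub>1 \<union> A\<^sub>2))"
proof -
  let ?A = "insert (r\<^sub>1, r\<^sub>2) (A\<^sub>1 \<union> A\<^sub>2)"
  have sub: "A\<^sub>1 \<subseteq> U\<^sub>1 \<times> U\<^sub>1" "A\<^sub>2 \<subseteq> U\<^sub>2 \<times> U\<^sub>2"
    and conn: "\<And>u v. u \<in> U\<^sub>1 \<Longrightarrow> v \<in> U\<^sub>1 \<Longrightarrow> (u, v) \<in> linked A\<^sub>1"
      "\<And>u v. u \<in> U\<^sub>2 \<Longrightarrow> v \<in> U\<^sub>2 \<Longrightarrow> (u, v) \<in> linked A\<^sub>2"
    and bridge: "\<And>x y. (x, y) \<in> A\<^sub>1 \<Longrightarrow> (x, y) \<notin> linked (A\<^sub>1 - {(x, y)})"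
      "\<And>x y. (x, y) \<in> A\<^sub>2 \<Longrightarrow> (x, y) \<notin> linked (A\<^sub>2 - {(x, y)})"
    using T\<^sub>1 T\<^sub>2 by (auto simp: oriented_tree_on_iff)
  have root: "(r\<^sub>1, v) \<in> linked ?A" if "v \<in> U\<^sub>1 \<union> U\<^sub>2" for v
    using that
  proof
    assume "v \<in> U\<^sub>1"
    then show ?thesis using conn(1)[OF r(1)] linked_mono[of A\<^sub>1 ?A] by blast
  next
    assume "v \<in> U\<^sub>2"
    then have "(r\<^sub>2, v) \<in> linked ?A" using conn(2)[OF r(2)] linked_mono[of A\<^sub>2 ?A] by blast
    then show ?thesis by (rule converse_rtrancl_into_rtrancl[rotated]) simp
  qed
  have "(u, v) \<in> linked ?A" if "u \<in> U\<^sub>1 \<union> U\<^sub>2" "v \<in> U\<^sub>1 \<union> U\<^sub>2" for u v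
    using root[OF that(2)] linked_sym[OF root[OF that(1)]] by (rule rtrancl_trans[rotated])
  moreover have "(x, y) \<notin> linked (?A - {(x, y)})" if xy: "(x, y) \<in> ?A" for x y
  proof
    assume L: "(x, y) \<in> linked (?A - {(x, y)})"
    consider "(x, y) = (r\<^sub>1, r\<^sub>2)" | "(x, y) \<in> A\<^sub>1" | "(x, y) \<in> A\<^sub>2" using xy by blast
    then show False
    proof cases
      case 1
      have "y \<in> U\<^sub>1"
        by (rule linked_closed[OF L]) (use 1 r sub disj in auto)
      then show False using 1 r disj by auto
    next
      case 2
      \<comment> \<open>This contraction identifies the ends of the new arc and of all arcs in
        \<open>A\<^sub>2\<close>, and fixes the ends of all arcs in
        \<open>A\<^sub>1\<close>.\<close>
      let ?f = "\<lambda>v. if v \<in> U\<^sub>1 then v else r\<^sub>1"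
      have "?A - {(x, y)} \<subseteq> (A\<^sub>1 - {(x, y)}) \<union> insert (r\<^sub>1, r\<^sub>2) A\<^sub>2" by blast
      then have "(x, y) \<in> linked ((A\<^sub>1 - {(x, y)}) \<union> insert (r\<^sub>1, r\<^sub>2) A\<^sub>2)"
        using L linked_mono by blast
      then have "(?f x, ?f y) \<in> linked (A\<^sub>1 - {(x, y)})"
        by (rule linked_retract) (use sub disj r in auto)
      moreover have "?f x = x" "?f y = y" using 2 sub by auto
      ultimately show False using bridge(1)[OF 2] by simp
    next
      case 3
      let ?f = "\<lambda>v. if v \<in> U\<^sub>2 then v else r\<^sub>2"
      have "?A - {(x, y)} \<subseteq> (A\<^sub>2 - {(x, y)}) \<union> insert (r\<^sub>1, r\<^sub>2) A\<^sub>1" by blast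
      then have "(x, y) \<in> linked ((A\<^sub>2 - {(x, y)}) \<union> insert (r\<^sub>1, r\<^sub>2) A\<^sub>1)"
        using L linked_mono by blast
      then have "(?f x, ?f y) \<in> linked (A\<^sub>2 - {(x, y)})"
        by (rule linked_retract) (use sub disj r in auto)
      moreover have "?f x = x" "?f y = y" using 3 sub by auto
      ultimately show False using bridge(2)[OF 3] by simp
    qed
  qed
  ultimately show ?thesis
    using sub r unfolding oriented_tree_on_iff by blast
qed

text \<open>A walk along \<open>B\<close> from \<open>r\<close> never leaves \<open>X\<close>, which
  gives connectedness. Bridges are inherited because deleting arcs only destroys links.\<close>

lemma oriented_tree_on_component:
  assumes T: "oriented_tree_on U A" and B: "B \<subseteq> A" and r: "r \<in> U"
  defines "X \<equiv> {v. (r, v) \<in> linked B}"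
  shows "oriented_tree_on X (B \<inter> X \<times> X)"
proof -
  let ?B = "B \<inter> X \<times> X"
  have closed: "v \<in> X" if "u \<in> X" "(u, v) \<in> B \<union> B\<inverse>" for u v
    using that unfolding X_def by (auto intro: rtrancl_into_rtrancl)
  have root: "(r, v) \<in> linked ?B" if "v \<in> X" for v
  proof -
    have "(r, v) \<in> linked B" using that by (simp add: X_def)
    then show ?thesis
    proof induction
      case (step y z)
      have "y \<in> X" using step.hyps(1) by (simp add: X_def)
      moreover from this have "z \<in> X" using closed step.hyps(2) by blast
      ultimately have "(y, z) \<in> ?B \<union> ?B\<inverse>" using step.hyps(2) by auto
      then show ?case using step.IH by (rule rtrancl_into_rtrancl[rotated])
    qed simp
  qed
  have "(u, v) \<in> linked ?B" if "u \<in> X" "v \<in> X" for u v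
    using root[OF that(2)] linked_sym[OF root[OF that(1)]] by (rule rtrancl_trans[rotated])
  moreover have "(x, y) \<notin> linked (?B - {(x, y)})" if "(x, y) \<in> ?B" for x y
  proof -
    have "(x, y) \<notin> linked (A - {(x, y)})" using T B that by (auto simp: oriented_tree_on_iff)
    moreover have "?B - {(x, y)} \<subseteq> A - {(x, y)}" using B by blast
    ultimately show ?thesis using linked_mono by blast
  qed
  moreover have "r \<in> X" by (simp add: X_def)
  ultimately show ?thesis unfolding oriented_tree_on_iff by blast
qed

text \<open>The two parts are the components of \<open>r\<^sub>1\<close> and
  \<open>r\<^sub>2\<close> after deletion of the arc. They are disjoint because the arc is a
  bridge.\<close>

lemma oriented_tree_on_split:
  assumes T: "oriented_tree_on U A" and r: "(r\<^sub>1, r\<^sub>2) \<in> A"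
  obtains U\<^sub>1 U\<^sub>2 A\<^sub>1 A\<^sub>2 where "U\<^sub>1 \<union> U\<^sub>2 = U" "U\<^sub>1 \<inter> U\<^sub>2 = {}" "r\<^sub>1 \<in> U\<^sub>1" "r\<^sub>2 \<in> U\<^sub>2"
    "oriented_tree_on U\<^sub>1 A\<^sub>1" "oriented_tree_on U\<^sub>2 A\<^sub>2" "A = insert (r\<^sub>1, r\<^sub>2) (A\<^sub>1 \<union> A\<^sub>2)"
proof -
  define B where "B = A - {(r\<^sub>1, r\<^sub>2)}"
  define X where "X r = {v. (r, v) \<in> linked B}" for r
  have AU: "A \<subseteq> U \<times> U" and conn: "\<And>u v. u \<in> U \<Longrightarrow> v \<in> U \<Longrightarrow> (u, v) \<in> linked A"
    and bridge: "(r\<^sub>1, r\<^sub>2) \<notin> linked B"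
    using T r by (auto simp: oriented_tree_on_iff B_def)
  have rU: "r\<^sub>1 \<in> U" "r\<^sub>2 \<in> U" using AU r by auto
  have X_root: "r \<in> X r" for r by (simp add: X_def)
  have X_iff: "a \<in> X r \<longleftrightarrow> b \<in> X r" if "(a, b) \<in> B" for a b r
    using that unfolding X_def by (auto intro: rtrancl_into_rtrancl)
  have X_sub: "X r \<subseteq> U" if "r \<in> U" for r
  proof
    fix v assume "v \<in> X r"
    then have "(r, v) \<in> linked B" by (simp add: X_def)
    then show "v \<in> U" by (rule linked_closed) (use that AU in \<open>auto simp: B_def\<close>)
  qed
  \<comment> \<open>The union of both components is closed under all arcs of \<open>A\<close>, the
    deleted one included, so connectedness of \<open>A\<close> makes it all of
    \<open>U\<close>.\<close>
  have "v \<in> X r\<^sub>1 \<union> X r\<^sub>2" if "v \<in> U" for v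
  proof (rule linked_closed[OF conn[OF rU(1) that]])
    show "a \<in> X r\<^sub>1 \<union> X r\<^sub>2 \<longleftrightarrow> b \<in> X r\<^sub>1 \<union> X r\<^sub>2" if "(a, b) \<in> A" for a b
      using that X_iff[of a b] X_root by (cases "(a, b) = (r\<^sub>1, r\<^sub>2)") (auto simp: B_def)
  qed (simp add: X_root)
  then have un: "X r\<^sub>1 \<union> X r\<^sub>2 = U" using X_sub rU by blast
  have "X r\<^sub>1 \<inter> X r\<^sub>2 = {}"
  proof (rule ccontr)
    assume "X r\<^sub>1 \<inter> X r\<^sub>2 \<noteq> {}"
    then obtain v where "(r\<^sub>1, v) \<in> linked B" "(r\<^sub>2, v) \<in> linked B" by (auto simp: X_def)
    then have "(r\<^sub>1, r\<^sub>2) \<in> linked B" using linked_sym rtrancl_trans by metis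
    then show False using bridge by simp
  qed
  moreover have "A = insert (r\<^sub>1, r\<^sub>2) (B \<inter> X r\<^sub>1 \<times> X r\<^sub>1 \<union> B \<inter> X r\<^sub>2 \<times> X r\<^sub>2)"
  proof -
    have "(a, b) \<in> X r\<^sub>1 \<times> X r\<^sub>1 \<union> X r\<^sub>2 \<times> X r\<^sub>2" if "(a, b) \<in> B" for a b
      using that un AU X_iff[OF that] by (auto simp: B_def)
    then show ?thesis using r unfolding B_def by auto
  qed
  moreover have "oriented_tree_on (X r) (B \<inter> X r \<times> X r)" if "r \<in> U" for r
    unfolding X_def by (rule oriented_tree_on_component[OF T _ that]) (auto simp: B_def)
  ultimately show ?thesis using that un X_root rU by blast
qed

section \<open>Counting arcs\<close>

text \<open>Strong induction, splitting at any arc: each part has one vertex more than arcs, and the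
  deleted arc makes up for one of these two surplus vertices.\<close>

lemma card_oriented_tree_on:
  assumes "finite U" and "oriented_tree_on U A"
  shows "card U = Suc (card A)"
  using assms
proof (induction "card U" arbitrary: U A rule: less_induct)
  case less
  note T = less.prems(2)
  show ?case
  proof (cases "A = {}")
    case True
    obtain u where "u \<in> U" using T unfolding oriented_tree_on_iff by blast
    moreover have "v = u" if "v \<in> U" for v
    proof -
      have "(u, v) \<in> linked A" using T \<open>u \<in> U\<close> that unfolding oriented_tree_on_iff by blast
      then show ?thesis using True by simp
    qed
    ultimately have "U = {u}" by blast
    then show ?thesis using True by simp
  next
    case False
    then obtain r\<^sub>1 r\<^sub>2 where "(r\<^sub>1, r\<^sub>2) \<in> A" by auto
    from oriented_tree_on_split[OF T this] obtain U\<^sub>1 U\<^sub>2 A\<^sub>1 A\<^sub>2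
      where s: "U\<^sub>1 \<union> U\<^sub>2 = U" "U\<^sub>1 \<inter> U\<^sub>2 = {}" "r\<^sub>1 \<in> U\<^sub>1" "r\<^sub>2 \<in> U\<^sub>2"
      "oriented_tree_on U\<^sub>1 A\<^sub>1" "oriented_tree_on U\<^sub>2 A\<^sub>2" "A = insert (r\<^sub>1, r\<^sub>2) (A\<^sub>1 \<union> A\<^sub>2)" .
    have fin: "finite U\<^sub>1" "finite U\<^sub>2" using less.prems(1) s(1) by auto
    have sub: "A\<^sub>1 \<subseteq> U\<^sub>1 \<times> U\<^sub>1" "A\<^sub>2 \<subseteq> U\<^sub>2 \<times> U\<^sub>2"
      using s(5,6) by (auto dest: oriented_tree_on_subset)
    then have finA: "finite A\<^sub>1" "finite A\<^sub>2" using fin by (auto intro: finite_subset)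
    have "U\<^sub>1 \<subset> U" "U\<^sub>2 \<subset> U" using s(1-4) by auto
    then have "card U\<^sub>1 < card U" "card U\<^sub>2 < card U"
      using less.prems(1) by (auto intro: psubset_card_mono)
    then have "card U\<^sub>1 = Suc (card A\<^sub>1)" "card U\<^sub>2 = Suc (card A\<^sub>2)"
      using less.hyps fin s(5,6) by auto
    moreover have "card U = card U\<^sub>1 + card U\<^sub>2" using s(1,2) fin card_Un_disjoint by blast
    moreover have "(r\<^sub>1, r\<^sub>2) \<notin> A\<^sub>1 \<union> A\<^sub>2" "A\<^sub>1 \<inter> A\<^sub>2 = {}" using sub s(2-4) by auto
    then have "card A = Suc (card A\<^sub>1 + card A\<^sub>2)"
      using s(7) finA by (simp add: card_Un_disjoint)
    ultimately show ?thesis by simp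
  qed
qed


section \<open>Pairs of rooted oriented trees\<close>

text \<open>The nesting is the one produced by \<open>species_prod\<close> and
  \<open>pointing\<close>, so that these values are literally the structures of the product
  species.\<close>

type_synonym 'a tree_pair =
  "('a set \<times> 'a set) \<times> (('a \<times> 'a) set \<times> 'a) \<times> (('a \<times> 'a) set \<times> 'a)"

text \<open>The order of the two factors becomes the direction of the new arc; only the knowledge of
  which arc is new gets lost.\<close>

fun join :: "'a tree_pair \<Rightarrow> ('a \<times> 'a) set" where
  "join ((U\<^sub>1, U\<^sub>2), (A\<^sub>1, r\<^sub>1), (A\<^sub>2, r\<^sub>2)) = insert (r\<^sub>1, r\<^sub>2) (A\<^sub>1 \<union> A\<^sub>2)"

fun joining_arc :: "'a tree_pair \<Rightarrow> 'a \<times> 'a" where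
  "joining_arc ((U\<^sub>1, U\<^sub>2), (A\<^sub>1, r\<^sub>1), (A\<^sub>2, r\<^sub>2)) = (r\<^sub>1, r\<^sub>2)"

text \<open>At a tie the head of the joining arc is chosen. Only sizes and the orientation enter, so
  the choice commutes with relabelling.\<close>

fun light_root :: "'a tree_pair \<Rightarrow> 'a" where
  "light_root ((U\<^sub>1, U\<^sub>2), (A\<^sub>1, r\<^sub>1), (A\<^sub>2, r\<^sub>2)) = (if card U\<^sub>2 \<le> card U\<^sub>1 then r\<^sub>2 else r\<^sub>1)"

abbreviation tree_pairs :: "'a set \<Rightarrow> 'a tree_pair set" where
  "tree_pairs \<equiv> structs (rooted_oriented_trees *\<^sub>s rooted_oriented_trees)"

lemma tree_pairs_iff:
  "((U\<^sub>1, U\<^sub>2), (A\<^sub>1, r\<^sub>1), (A\<^sub>2, r\<^sub>2)) \<in> tree_pairs U \<longleftrightarrow>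
     U\<^sub>1 \<union> U\<^sub>2 = U \<and> U\<^sub>1 \<inter> U\<^sub>2 = {} \<and> oriented_tree_on U\<^sub>1 A\<^sub>1 \<and> r\<^sub>1 \<in> U\<^sub>1
       \<and> oriented_tree_on U\<^sub>2 A\<^sub>2 \<and> r\<^sub>2 \<in> U\<^sub>2"
  by (auto simp: species_prod_def rooted_oriented_trees_def pointing_def oriented_trees_def)

lemma tree_pairsE:
  assumes "p \<in> tree_pairs U"
  obtains U\<^sub>1 U\<^sub>2 A\<^sub>1 r\<^sub>1 A\<^sub>2 r\<^sub>2 where "p = ((U\<^sub>1, U\<^sub>2), (A\<^sub>1, r\<^sub>1), (A\<^sub>2, r\<^sub>2))"
    "U\<^sub>1 \<union> U\<^sub>2 = U" "U\<^sub>1 \<inter> U\<^sub>2 = {}" "oriented_tree_on U\<^sub>1 A\<^sub>1" "r\<^sub>1 \<in> U\<^sub>1"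
    "oriented_tree_on U\<^sub>2 A\<^sub>2" "r\<^sub>2 \<in> U\<^sub>2"
  using assms that by (cases p rule: join.cases) (auto simp: tree_pairs_iff)

lemma join_oriented_tree: "p \<in> tree_pairs U \<Longrightarrow> oriented_tree_on U (join p)"
  by (erule tree_pairsE) (auto intro: oriented_tree_on_join)

lemma light_root_in: "p \<in> tree_pairs U \<Longrightarrow> light_root p \<in> U"
  by (erule tree_pairsE) auto

text \<open>The pair can be recovered from its join and its joining arc: deleting the arc leaves the
  two trees, and their vertex sets are the components of the roots.\<close>

lemma tree_pair_components:
  assumes "((U\<^sub>1, U\<^sub>2), (A\<^sub>1, r\<^sub>1), (A\<^sub>2, r\<^sub>2)) \<in> tree_pairs U"
    and "A = insert (r\<^sub>1, r\<^sub>2) (A\<^sub>1 \<union> A\<^sub>2)" and "B = A - {(r\<^sub>1, r\<^sub>2)}"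
  shows "U\<^sub>1 = {v. (r\<^sub>1, v) \<in> linked B}" "U\<^sub>2 = {v. (r\<^sub>2, v) \<in> linked B}"
    "A\<^sub>1 = B \<inter> U\<^sub>1 \<times> U\<^sub>1" "A\<^sub>2 = B \<inter> U\<^sub>2 \<times> U\<^sub>2"
proof -
  have disj: "U\<^sub>1 \<inter> U\<^sub>2 = {}" and r: "r\<^sub>1 \<in> U\<^sub>1" "r\<^sub>2 \<in> U\<^sub>2"
    and sub: "A\<^sub>1 \<subseteq> U\<^sub>1 \<times> U\<^sub>1" "A\<^sub>2 \<subseteq> U\<^sub>2 \<times> U\<^sub>2"
    and conn: "\<And>u v. u \<in> U\<^sub>1 \<Longrightarrow> v \<in> U\<^sub>1 \<Longrightarrow> (u, v) \<in> linked A\<^sub>1"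
      "\<And>u v. u \<in> U\<^sub>2 \<Longrightarrow> v \<in> U\<^sub>2 \<Longrightarrow> (u, v) \<in> linked A\<^sub>2"
    using assms(1) by (auto simp: tree_pairs_iff oriented_tree_on_iff)
  have B: "B = A\<^sub>1 \<union> A\<^sub>2" using assms(2,3) sub disj r by auto
  have "linked A\<^sub>1 \<subseteq> linked B" "linked A\<^sub>2 \<subseteq> linked B" unfolding B by (auto intro!: linked_mono)
  moreover have "v \<in> U\<^sub>1" if "(r\<^sub>1, v) \<in> linked B" for v
    by (rule linked_closed[OF that r(1)]) (use B sub disj in auto)
  moreover have "v \<in> U\<^sub>2" if "(r\<^sub>2, v) \<in> linked B" for v
    by (rule linked_closed[OF that r(2)]) (use B sub disj in auto)
  ultimately show "U\<^sub>1 = {v. (r\<^sub>1, v) \<in> linked B}" "U\<^sub>2 = {v. (r\<^sub>2, v) \<in> linked B}"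
    using conn(1)[OF r(1)] conn(2)[OF r(2)] by blast+
  show "A\<^sub>1 = B \<inter> U\<^sub>1 \<times> U\<^sub>1" "A\<^sub>2 = B \<inter> U\<^sub>2 \<times> U\<^sub>2" using B sub disj by auto
qed

lemma tree_pair_eqI:
  assumes p: "p \<in> tree_pairs U" and q: "q \<in> tree_pairs U"
    and join: "join p = join q" and arc: "joining_arc p = joining_arc q"
  shows "p = q"
proof -
  obtain U\<^sub>1 U\<^sub>2 A\<^sub>1 r\<^sub>1 A\<^sub>2 r\<^sub>2 where p': "p = ((U\<^sub>1, U\<^sub>2), (A\<^sub>1, r\<^sub>1), (A\<^sub>2, r\<^sub>2))"
    by (cases p rule: join.cases)
  obtain V\<^sub>1 V\<^sub>2 B\<^sub>1 s\<^sub>1 B\<^sub>2 s\<^sub>2 where q': "q = ((V\<^sub>1, V\<^sub>2), (B\<^sub>1, s\<^sub>1), (B\<^sub>2, s\<^sub>2))"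
    by (cases q rule: join.cases)
  have s: "s\<^sub>1 = r\<^sub>1" "s\<^sub>2 = r\<^sub>2" using arc by (simp_all add: p' q')
  have "join p = insert (r\<^sub>1, r\<^sub>2) (A\<^sub>1 \<union> A\<^sub>2)" "join p = insert (r\<^sub>1, r\<^sub>2) (B\<^sub>1 \<union> B\<^sub>2)"
    using join by (simp_all add: p' q' s)
  note P = tree_pair_components[OF p[unfolded p'] this(1) refl]
    and Q = tree_pair_components[OF q[unfolded q' s] this(2) refl]
  have U: "U\<^sub>1 = V\<^sub>1" "U\<^sub>2 = V\<^sub>2" using P(1,2) Q(1,2) by simp_all
  have "A\<^sub>1 = B\<^sub>1" "A\<^sub>2 = B\<^sub>2" using P(3,4) Q(3,4) unfolding U by (metis, metis)
  then show ?thesis by (simp add: p' q' s U)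
qed

text \<open>This makes precise that a pair is an oriented tree with a distinguished arc: recovering
  the pair gives injectivity, splitting the tree gives surjectivity.\<close>

lemma bij_betw_joining_arc:
  assumes T: "oriented_tree_on U A"
  shows "bij_betw joining_arc {p \<in> tree_pairs U. join p = A} A"
proof (rule bij_betw_imageI)
  show "inj_on joining_arc {p \<in> tree_pairs U. join p = A}"
    by (rule inj_onI) (blast intro: tree_pair_eqI)
  show "joining_arc ` {p \<in> tree_pairs U. join p = A} = A"
  proof (intro equalityI subsetI)
    fix a assume "a \<in> joining_arc ` {p \<in> tree_pairs U. join p = A}"
    then show "a \<in> A" by (auto elim!: tree_pairsE)
  next
    fix a assume a: "a \<in> A"
    obtain r\<^sub>1 r\<^sub>2 where r: "a = (r\<^sub>1, r\<^sub>2)" by (cases a)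
    from oriented_tree_on_split[OF T a[unfolded r]] obtain U\<^sub>1 U\<^sub>2 A\<^sub>1 A\<^sub>2
      where s: "U\<^sub>1 \<union> U\<^sub>2 = U" "U\<^sub>1 \<inter> U\<^sub>2 = {}" "r\<^sub>1 \<in> U\<^sub>1" "r\<^sub>2 \<in> U\<^sub>2"
      "oriented_tree_on U\<^sub>1 A\<^sub>1" "oriented_tree_on U\<^sub>2 A\<^sub>2" "A = insert (r\<^sub>1, r\<^sub>2) (A\<^sub>1 \<union> A\<^sub>2)" .
    let ?p = "((U\<^sub>1, U\<^sub>2), (A\<^sub>1, r\<^sub>1), (A\<^sub>2, r\<^sub>2))"
    have "?p \<in> tree_pairs U" using s(1-6) by (simp add: tree_pairs_iff)
    moreover have "join ?p = A" using s(7) by simp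
    moreover have "a = joining_arc ?p" by (simp add: r)
    ultimately show "a \<in> joining_arc ` {p \<in> tree_pairs U. join p = A}" by blast
  qed
qed

section \<open>Distinct arcs of a tree have distinct light roots\<close>

text \<open>Describes a pair by its light part \<open>L\<close> and heavy part \<open>H\<close> and
  hides which factor is which, so that comparing two pairs needs no case distinction on the order of
  the factors.\<close>

lemma light_root_sides:
  assumes "finite U" and "p \<in> tree_pairs U"
  obtains L H h B C where "L \<union> H = U" "L \<inter> H = {}" "light_root p \<in> L" "h \<in> H"
    "B \<subseteq> L \<times> L" "C \<subseteq> H \<times> H" "join p = insert (joining_arc p) (B \<union> C)"
    "joining_arc p = (light_root p, h) \<or> joining_arc p = (h, light_root p)"
    "\<forall>v\<in>H. (h, v) \<in> linked C" "card U \<le> 2 * card H"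
proof -
  obtain U\<^sub>1 U\<^sub>2 A\<^sub>1 r\<^sub>1 A\<^sub>2 r\<^sub>2 where p: "p = ((U\<^sub>1, U\<^sub>2), (A\<^sub>1, r\<^sub>1), (A\<^sub>2, r\<^sub>2))"
    and U: "U\<^sub>1 \<union> U\<^sub>2 = U" "U\<^sub>1 \<inter> U\<^sub>2 = {}" and r: "r\<^sub>1 \<in> U\<^sub>1" "r\<^sub>2 \<in> U\<^sub>2"
    and T: "oriented_tree_on U\<^sub>1 A\<^sub>1" "oriented_tree_on U\<^sub>2 A\<^sub>2"
    using assms(2) by (rule tree_pairsE)
  have card: "card U = card U\<^sub>1 + card U\<^sub>2"
    using U assms(1) by (metis card_Un_disjoint finite_Un)
  show ?thesis
  proof (cases "card U\<^sub>2 \<le> card U\<^sub>1")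
    case True
    show ?thesis
      by (rule that[of U\<^sub>2 U\<^sub>1 r\<^sub>1 A\<^sub>2 A\<^sub>1])
        (use True U r T card in \<open>auto simp: p oriented_tree_on_iff\<close>)
  next
    case False
    show ?thesis
      by (rule that[of U\<^sub>1 U\<^sub>2 r\<^sub>2 A\<^sub>1 A\<^sub>2])
        (use False U r T card in \<open>auto simp: p oriented_tree_on_iff\<close>)
  qed
qed

lemma light_root_inj:
  assumes U: "finite U" and p: "p \<in> tree_pairs U" and q: "q \<in> tree_pairs U"
    and join: "join p = join q" and light: "light_root p = light_root q"
  shows "p = q"
proof (rule ccontr)
  assume "p \<noteq> q"
  then have arcs: "joining_arc p \<noteq> joining_arc q" using tree_pair_eqI[OF p q join] by blast
  let ?u = "light_root p" and ?a = "joining_arc p" and ?b = "joining_arc q"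
  obtain L H h B C where P: "L \<union> H = U" "L \<inter> H = {}" "?u \<in> L" "h \<in> H"
    "B \<subseteq> L \<times> L" "C \<subseteq> H \<times> H" "join p = insert ?a (B \<union> C)"
    "?a = (?u, h) \<or> ?a = (h, ?u)"
    "\<forall>v\<in>H. (h, v) \<in> linked C" "card U \<le> 2 * card H"
    using light_root_sides[OF U p] .
  obtain L' H' h' B' C' where Q: "L' \<union> H' = U" "L' \<inter> H' = {}" "?u \<in> L'" "h' \<in> H'"
    "B' \<subseteq> L' \<times> L'" "C' \<subseteq> H' \<times> H'" "join p = insert ?b (B' \<union> C')"
    "?b = (?u, h') \<or> ?b = (h', ?u)" "card U \<le> 2 * card H'"
    using light_root_sides[OF U q] unfolding light[symmetric] join[symmetric] by metis
  have arcs_eq: "insert ?a (B \<union> C) = insert ?b (B' \<union> C')" using P(7) Q(7) by (rule trans[OF sym])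
  \<comment> \<open>The arc \<open>?b\<close> has the end \<open>?u\<close>, which lies outside
    \<open>H\<close>. Hence no arc of \<open>C\<close> crosses the cut belonging to
    \<open>q\<close>.\<close>
  have "?b \<notin> C" using Q(8) P(2,3,6) by auto
  moreover have "C \<subseteq> insert ?b (B' \<union> C')" unfolding arcs_eq[symmetric] by blast
  ultimately have C: "C \<subseteq> B' \<union> C'" by blast
  \<comment> \<open>Being different from \<open>?b\<close>, the arc \<open>?a\<close> does not cross
    the cut of \<open>q\<close> either, so its end \<open>h\<close> lies on the same side as
    \<open>?u\<close>. As \<open>H\<close> is connected through \<open>C\<close>, all of it follows
    \<open>h\<close> into \<open>L'\<close>.\<close>
  have "?a \<in> B' \<union> C'" using arcs_eq arcs by blast
  then have "h \<in> L'" using P(8) Q(2,3,5,6) by auto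
  have "H \<subseteq> L'"
  proof
    fix v assume "v \<in> H"
    show "v \<in> L'"
      by (rule linked_closed[OF bspec[OF P(9) \<open>v \<in> H\<close>] \<open>h \<in> L'\<close>]) (use C Q(2,5,6) in auto)
  qed
  then have "H \<inter> H' = {}" "H \<union> H' \<subseteq> U - {?u}" using P(1-3) Q(1-3) by auto
  moreover have "finite H" "finite H'" using U P(1) Q(1) by (metis finite_Un)+
  ultimately have "card H + card H' \<le> card (U - {?u})"
    using U by (metis card_Un_disjoint card_mono finite_Diff)
  moreover have "card (U - {?u}) < card U" using U P(1,3) by (intro card_Diff1_less) auto
  ultimately show False using P(10) Q(9) by simp
qed

text \<open>The pairs joining to \<open>A\<close> are as many as its arcs, one fewer than the
  vertices, and their light roots are distinct.\<close>

lemma ex1_not_light_root: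
  assumes U: "finite U" and T: "oriented_tree_on U A"
  shows "\<exists>!u. u \<in> U \<and> (\<forall>p\<in>tree_pairs U. join p = A \<longrightarrow> light_root p \<noteq> u)"
proof -
  let ?P = "{p \<in> tree_pairs U. join p = A}"
  have "inj_on light_root ?P" by (rule inj_onI) (blast intro: light_root_inj[OF U])
  then have "card (light_root ` ?P) = card A"
    using bij_betw_same_card[OF bij_betw_joining_arc[OF T]] by (simp add: card_image)
  moreover have "light_root ` ?P \<subseteq> U" using light_root_in by blast
  ultimately have "card (U - light_root ` ?P) = 1"
    using card_oriented_tree_on[OF U T] U by (simp add: card_Diff_subset finite_subset)
  then obtain u where "U - light_root ` ?P = {u}" by (rule card_1_singletonE)
  then show ?thesis by (intro ex1I[of _ u]) blast+
qed

section \<open>The vertex that is no light root\<close>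

text \<open>For a finite oriented tree this is a centroid: every branch at it contains at most half
  of the vertices. If there are two centroids, it is the tail of the arc between them.\<close>

definition centre :: "'a set \<Rightarrow> ('a \<times> 'a) set \<Rightarrow> 'a" where
  "centre U A = (THE u. u \<in> U \<and> (\<forall>p\<in>tree_pairs U. join p = A \<longrightarrow> light_root p \<noteq> u))"

lemma centre:
  assumes "finite U" and "oriented_tree_on U A"
  shows "centre U A \<in> U" "\<And>p. p \<in> tree_pairs U \<Longrightarrow> join p = A \<Longrightarrow> light_root p \<noteq> centre U A"
  using theI'[OF ex1_not_light_root[OF assms], folded centre_def] by blast+

lemma centre_eqI:
  assumes "finite U" and "oriented_tree_on U A" and "u \<in> U"
    and "\<And>p. p \<in> tree_pairs U \<Longrightarrow> join p = A \<Longrightarrow> light_root p \<noteq> u"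
  shows "centre U A = u"
  using centre[OF assms(1,2)] ex1_not_light_root[OF assms(1,2)] assms(3,4) by blast


section \<open>The natural isomorphism\<close>

text \<open>Naturality passes to the inverse because every component is bijective. It is used to
  turn \<open>root_at\<close>, which starts from the sum, into an isomorphism starting from the
  rooted trees.\<close>

lemma natural_iso_inverse:
  assumes "species F" and "natural_iso F G \<alpha>"
  shows "natural_iso G F (\<lambda>U. inv_into (structs F U) (\<alpha> U))"
proof -
  interpret species F by fact
  have bij: "bij_betw (\<alpha> U) (structs F U) (structs G U)" if "finite U" for U
    using assms(2) that by (simp add: natural_iso_def)
  have "inv_into (structs F V) (\<alpha> V) (transport G U \<sigma> t)
      = transport F U \<sigma> (inv_into (structs F U) (\<alpha> U) t)"
    if U: "finite U" and \<sigma>: "bij_betw \<sigma> U V" and t: "t \<in> structs G U" for U V \<sigma> t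
  proof -
    obtain s where s: "s \<in> structs F U" "t = \<alpha> U s" using bij[OF U] t by (auto simp: bij_betw_def)
    have "finite V" using U \<sigma> bij_betw_finite by blast
    moreover have "transport G U \<sigma> t = \<alpha> V (transport F U \<sigma> s)"
      using assms(2) U \<sigma> s by (auto simp: natural_iso_def)
    ultimately show ?thesis
      using bij_betw_inv_into_left[OF bij] transport_in[OF U \<sigma> s(1)] s U by simp
  qed
  then show ?thesis
    using bij by (auto simp: natural_iso_def intro: bij_betw_inv_into)
qed

lemma transport_oriented_trees: "transport oriented_trees U \<sigma> A = map_prod \<sigma> \<sigma> ` A"
  by (simp add: oriented_trees_def)

lemma structs_oriented_trees: "structs oriented_trees U = {A. oriented_tree_on U A}"
  by (simp add: oriented_trees_def)

lemma join_transport: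
  "join (transport (rooted_oriented_trees *\<^sub>s rooted_oriented_trees) U \<sigma> p) = map_prod \<sigma> \<sigma> ` join p"
  by (cases p rule: join.cases)
    (simp add: species_prod_def rooted_oriented_trees_def pointing_def oriented_trees_def image_Un)

text \<open>An injective relabelling preserves the sizes of both parts, so the comparison, including
  the case of a tie, has the same outcome.\<close>

lemma light_root_transport:
  assumes "inj_on \<sigma> U" and "p \<in> tree_pairs U"
  shows "light_root (transport (rooted_oriented_trees *\<^sub>s rooted_oriented_trees) U \<sigma> p)
    = \<sigma> (light_root p)"
  using assms(2)
proof (rule tree_pairsE)
  fix U\<^sub>1 U\<^sub>2 A\<^sub>1 r\<^sub>1 A\<^sub>2 r\<^sub>2
  assume p: "p = ((U\<^sub>1, U\<^sub>2), (A\<^sub>1, r\<^sub>1), (A\<^sub>2, r\<^sub>2))" and "U\<^sub>1 \<union> U\<^sub>2 = U"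
  then have "inj_on \<sigma> U\<^sub>1" "inj_on \<sigma> U\<^sub>2" using assms(1) by (auto intro: inj_on_subset)
  then show ?thesis
    by (simp add: p species_prod_def rooted_oriented_trees_def pointing_def card_image)
qed

text \<open>The centre is singled out by a condition on pairs, and every pair over the relabelled
  tree is the transport of a pair over \<open>A\<close>.\<close>

lemma centre_transport:
  fixes U V :: "'a set"
  assumes U: "finite U" and \<sigma>: "bij_betw \<sigma> U V" and T: "oriented_tree_on U A"
  shows "centre V (map_prod \<sigma> \<sigma> ` A) = \<sigma> (centre U A)"
proof -
  interpret o: species "oriented_trees :: ('a, ('a \<times> 'a) set) species_data"
    by (rule species_oriented_trees)
  let ?S = "rooted_oriented_trees *\<^sub>s rooted_oriented_trees :: ('a, 'a tree_pair) species_data"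
  interpret P: species ?S by (intro species_prod species_rooted_oriented_trees)
  have V: "finite V" using U \<sigma> bij_betw_finite by blast
  have inj: "inj_on \<sigma> U" using \<sigma> by (simp add: bij_betw_def)
  note bij = o.transport_bij[OF U \<sigma>, unfolded structs_oriented_trees]
  show ?thesis
  proof (rule centre_eqI[OF V])
    show "oriented_tree_on V (map_prod \<sigma> \<sigma> ` A)"
      using bij_betwE[OF bij] T by (simp add: transport_oriented_trees)
    show "\<sigma> (centre U A) \<in> V" using centre(1)[OF U T] \<sigma> by (rule bij_betw_apply[rotated])
    fix q assume q: "q \<in> tree_pairs V" "join q = map_prod \<sigma> \<sigma> ` A"
    then obtain p where p: "p \<in> tree_pairs U" "q = transport ?S U \<sigma> p"
      using bij_betw_imp_surj_on[OF P.transport_bij[OF U \<sigma>]] by blast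
    \<comment> \<open>Transport is injective on the oriented trees on \<open>U\<close>, so \<sigma>
      can be cancelled.\<close>
    have "transport oriented_trees U \<sigma> (join p) = transport oriented_trees U \<sigma> A"
      using q(2) by (simp add: p(2) join_transport transport_oriented_trees)
    then have "join p = A"
      using bij T join_oriented_tree[OF p(1)] by (auto simp: bij_betw_def dest: inj_onD)
    then have "light_root p \<noteq> centre U A" using centre(2)[OF U T p(1)] by simp
    then show "light_root q \<noteq> \<sigma> (centre U A)"
      using light_root_transport[OF inj p(1)] light_root_in[OF p(1)] centre(1)[OF U T] inj
      by (auto simp: p(2) dest: inj_onD)
  qed
qed

text \<open>This direction has explicit formulas, whereas its inverse must first decide whether a
  given root is the centre. An unrooted tree receives the one root that no pair produces.\<close>

fun root_at :: "'a set \<Rightarrow> ('a \<times> 'a) set + 'a tree_pair \<Rightarrow> ('a \<times> 'a) set \<times> 'a" where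
  "root_at U (Inl A) = (A, centre U A)"
| "root_at U (Inr p) = (join p, light_root p)"

text \<open>Over a fixed tree, each vertex is either the light root of exactly one pair or the
  centre, which gives bijectivity. Naturality combines the transport rules for joins, light roots
  and centres.\<close>

lemma natural_iso_root_at:
  "natural_iso (oriented_trees +\<^sub>s rooted_oriented_trees *\<^sub>s rooted_oriented_trees)
     rooted_oriented_trees root_at"
proof -
  let ?S = "oriented_trees +\<^sub>s rooted_oriented_trees *\<^sub>s rooted_oriented_trees"
  have structs: "structs ?S U = {A. oriented_tree_on U A} <+> tree_pairs U"
    "structs rooted_oriented_trees U = {A. oriented_tree_on U A} \<times> U" for U :: "'a set"
    by (simp_all add: species_sum_def structs_oriented_trees rooted_oriented_trees_def pointing_def)
  have "bij_betw (root_at U) (structs ?S U) (structs rooted_oriented_trees U)"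
    if U: "finite U" for U :: "'a set"
  proof (rule bij_betw_imageI)
    show "inj_on (root_at U) (structs ?S U)"
    proof (rule inj_onI)
      fix s t :: "('a \<times> 'a) set + 'a tree_pair"
      assume s: "s \<in> structs ?S U" and t: "t \<in> structs ?S U"
        and eq: "root_at U s = root_at U t"
      have no_clash: False
        if "oriented_tree_on U A" "p \<in> tree_pairs U" "(A, centre U A) = (join p, light_root p)" for A p
        using centre(2)[OF U that(1,2)] that(3) by auto
      from s t show "s = t"
        unfolding structs
      proof (elim PlusE)
        fix A p assume "A \<in> {A. oriented_tree_on U A}" "p \<in> tree_pairs U" "s = Inl A" "t = Inr p"
        then show ?thesis using no_clash[of A p] eq by auto
      next
        fix A p assume "A \<in> {A. oriented_tree_on U A}" "p \<in> tree_pairs U" "s = Inr p" "t = Inl A"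
        then show ?thesis using no_clash[of A p] eq by auto
      next
        fix p q assume "p \<in> tree_pairs U" "q \<in> tree_pairs U" "s = Inr p" "t = Inr q"
        then show ?thesis using light_root_inj[OF U, of p q] eq by simp
      qed (use eq in simp)
    qed
    show "root_at U ` structs ?S U = structs rooted_oriented_trees U"
    proof (intro equalityI subsetI)
      fix x assume "x \<in> root_at U ` structs ?S U"
      then show "x \<in> structs rooted_oriented_trees U"
        unfolding structs using centre(1)[OF U] join_oriented_tree light_root_in by fastforce
    next
      fix x assume "x \<in> structs rooted_oriented_trees U"
      then obtain A u where x: "x = (A, u)" "oriented_tree_on U A" "u \<in> U"
        by (auto simp: structs)
      show "x \<in> root_at U ` structs ?S U"
      proof (cases "\<exists>p\<in>tree_pairs U. join p = A \<and> light_root p = u")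
        case True
        then obtain p where "p \<in> tree_pairs U" "x = root_at U (Inr p)" by (auto simp: x)
        then show ?thesis unfolding structs by blast
      next
        case False
        then have "centre U A = u" by (intro centre_eqI[OF U x(2,3)]) blast
        then have "x = root_at U (Inl A)" by (simp add: x)
        then show ?thesis using x(2) unfolding structs by blast
      qed
    qed
  qed
  moreover have "root_at V (transport ?S U \<sigma> s)
      = transport rooted_oriented_trees U \<sigma> (root_at U s)"
    if U: "finite U" and \<sigma>: "bij_betw \<sigma> U V" and s: "s \<in> structs ?S U"
    for U V :: "'a set" and \<sigma> s
  proof (cases s)
    case (Inl A)
    then show ?thesis
      using s centre_transport[OF U \<sigma>, of A] unfolding structs
      by (auto simp: species_sum_def rooted_oriented_trees_def pointing_def transport_oriented_trees)
  next
    case (Inr p)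
    then have "light_root (transport (rooted_oriented_trees *\<^sub>s rooted_oriented_trees) U \<sigma> p)
        = \<sigma> (light_root p)"
      using s \<sigma> unfolding structs by (intro light_root_transport) (auto simp: bij_betw_def)
    then show ?thesis
      using Inr join_transport[of U \<sigma> p]
      by (simp add: species_sum_def)
        (simp add: rooted_oriented_trees_def pointing_def transport_oriented_trees)
  qed
  ultimately show ?thesis by (auto simp: natural_iso_def)
qed

theorem mainTheorem16:
  shows "(rooted_oriented_trees :: ('a, ('a \<times> 'a) set \<times> 'a) species_data)
           \<cong>\<^sub>s oriented_trees +\<^sub>s rooted_oriented_trees *\<^sub>s rooted_oriented_trees"
proof -
  have "species (oriented_trees +\<^sub>s rooted_oriented_trees *\<^sub>s rooted_oriented_trees
      :: ('a, ('a \<times> 'a) set + 'a tree_pair) species_data)"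
    by (intro species_sum species_prod species_oriented_trees species_rooted_oriented_trees)
  then show ?thesis
    unfolding species_iso_def
    using species_rooted_oriented_trees natural_iso_inverse natural_iso_root_at by blast
qed

end
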